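(* Let $\boldsymbol{\Gamma}=\coprod_{i\in\mathbb{N}}\Gamma_i$ be the disjoint union of an expander sequence $\{\Gamma_i\}_{i\in\mathbb{N}}$, equipped with a proper metric $d$ such that the restriction of $d$ to each $\Gamma_i$ is the graph metric on $\Gamma_i$, and such that the distance $d(\Gamma_i,\Gamma_i^c)$ between $\Gamma_i$ and its complement $\Gamma_i^c$ in $\boldsymbol{\Gamma}$ tends to infinity as $i\to\infty$. Then $\boldsymbol{\Gamma}$ does not have property A.
   Context: Graphs. A finite graph $\Gamma$ has a finite non-empty vertex set, also denoted $\Gamma$, and a set $E$ of directed edges, regarded as ordered pairs of vertices, with an edge from $x$ to $y$ if and only if there is an edge from $y$ to $x$. $|\Gamma|$ denotes the number of vertices. The valency of a vertex is the number of directed edges starting at it. The graph metric is the length of a shortest edge path. The points of $\boldsymbol{\Gamma}$ are the vertices of the $\Gamma_i$, and $d(A,B)=\inf\{d(a,b):a\in A,b\in B\}$. Expanders. The Cheeger constant of $\Gamma$ is $h(\Gamma)=\frac12\inf\frac{|\partial F|}{|F|}$, where $F$ ranges over the non-empty subsets of $\Gamma$ with $|F|\le\frac12|\Gamma|$ (the infimum over the empty family being $+\infty$) and $\partial F$ is the set of directed edges with exactly one end point in $F$. $\Gamma$ is a $(k,\varepsilon)$-expander if each vertex has valency at most $k$ and $h(\Gamma)\ge\varepsilon$. A sequence $\{\Gamma_i\}$ of finite graphs is an expander sequence if $|\Gamma_i|\to\infty$ and there exist $k$ and $\varepsilon>0$ such that every $\Gamma_i$ is a $(k,\varepsilon)$-expander.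 Property A. A metric space $X$ has bounded geometry if for each $R>0$ there is $N$ such that every ball of radius $R$ in $X$ contains at most $N$ points. Let $\mathrm{Prob}(X)$ be the set of non-negative functions in $\ell^1(X)$ with sum $1$, and $B_S(x)$ the ball of radius $S$ about $x$. A discrete bounded geometry metric space $X$ has property A if for each $x\in X$ and each $n\in\mathbb{N}$ there is an element $f_n(x)\in\mathrm{Prob}(X)$ such that (1) there is a sequence $S_n$ with $\mathrm{supp}(f_n(x))\subseteq B_{S_n}(x)$ for all $x\in X$ and all $n$, and (2) for any $R>0$, $\|f_n(x_1)-f_n(x_0)\|_{\ell^1}\to0$ as $n\to\infty$ uniformly on the set $\{(x_0,x_1):d(x_0,x_1)\le R\}$. *)

theory Defs
  imports
    "Graph_Theory.Pair_Digraph"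
    "Graph_Theory.Shortest_Path"
    "HOL-Analysis.Analysis"
begin

section \<open>Graphs\<close>

text \<open>
  The edges are the directed arcs: an undirected edge between distinct vertices counts twice, in
  valencies (one arc at each end) as well as in edge boundaries. Loops are not excluded.
\<close>

definition finite_graph :: "'a pair_pre_digraph \<Rightarrow> bool" where
  "finite_graph G \<longleftrightarrow> pair_pseudo_graph G \<and> pverts G \<noteq> {}"

abbreviation valency :: "'a pair_pre_digraph \<Rightarrow> 'a \<Rightarrow> nat" where
  "valency G v \<equiv> out_degree (with_proj G) v"

text \<open>The value is \<open>\<infinity>\<close> if no edge path joins the two vertices.\<close>

definition graph_dist :: "'a pair_pre_digraph \<Rightarrow> 'a \<Rightarrow> 'a \<Rightarrow> ereal" where
  "graph_dist G u v = wf_digraph.\<mu> (with_proj G) (\<lambda>_. 1) u v"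


section \<open>Expanders\<close>

definition edge_boundary :: "'a pair_pre_digraph \<Rightarrow> 'a set \<Rightarrow> ('a \<times> 'a) set" where
  "edge_boundary G F = {(x, y) \<in> parcs G. (x \<in> F) \<noteq> (y \<in> F)}"

text \<open>Extended reals, since for a one-vertex graph the infimum is over the empty family.\<close>

definition cheeger_constant :: "'a pair_pre_digraph \<Rightarrow> ereal" where
  "cheeger_constant G = ereal (1 / 2) *
     (INF F \<in> {F. F \<subseteq> pverts G \<and> F \<noteq> {} \<and> real (card F) \<le> real (card (pverts G)) / 2}.
        ereal (real (card (edge_boundary G F)) / real (card F)))"

definition expander :: "nat \<Rightarrow> real \<Rightarrow> 'a pair_pre_digraph \<Rightarrow> bool" where
  "expander k \<epsilon> G \<longleftrightarrow>
     (\<forall>v \<in> pverts G. valency G v \<le> k) \<and> ereal \<epsilon> \<le> cheeger_constant G"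

definition expander_sequence :: "(nat \<Rightarrow> 'a pair_pre_digraph) \<Rightarrow> bool" where
  "expander_sequence \<Gamma> \<longleftrightarrow>
     (\<forall>i. finite_graph (\<Gamma> i)) \<and>
     filterlim (\<lambda>i. card (pverts (\<Gamma> i))) at_top sequentially \<and>
     (\<exists>k. \<exists>\<epsilon>>0. \<forall>i. expander k \<epsilon> (\<Gamma> i))"


section \<open>Metric notions\<close>

definition proper_metric :: "'a metric \<Rightarrow> bool" where
  "proper_metric m \<longleftrightarrow> (\<forall>x \<in> mspace m. \<forall>r. compactin (mtopology_of m) (mcball_of m x r))"

text \<open>Meaningful for non-empty subsets of the space only, as the infimum is taken in the reals.\<close>

definition set_dist :: "'a metric \<Rightarrow> 'a set \<Rightarrow> 'a set \<Rightarrow> real" where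
  "set_dist m A B = (INF (a, b) \<in> A \<times> B. mdist m a b)"


section \<open>Property A\<close>

text \<open>
  Functions on a set \<open>X\<close> are total functions whose values outside \<open>X\<close> are ignored.
\<close>

definition Prob :: "'a set \<Rightarrow> ('a \<Rightarrow> real) set" where
  "Prob X = {f. (\<forall>x \<in> X. 0 \<le> f x) \<and> (\<lambda>x. \<bar>f x\<bar>) summable_on X \<and> (\<Sum>\<^sub>\<infinity>x\<in>X. f x) = 1}"

definition l1_norm :: "'a set \<Rightarrow> ('a \<Rightarrow> real) \<Rightarrow> real" where
  "l1_norm X f = (\<Sum>\<^sub>\<infinity>x\<in>X. \<bar>f x\<bar>)"

text \<open>
  Property A is usually considered for discrete spaces of bounded geometry only. These standing
  assumptions are deliberately not conjuncts of the definition, so that its negation says that no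
  such functions exist, and never merely that a standing assumption fails.
\<close>

definition property_A :: "'a metric \<Rightarrow> bool" where
  "property_A m \<longleftrightarrow>
     (\<exists>f :: nat \<Rightarrow> 'a \<Rightarrow> 'a \<Rightarrow> real.
        (\<forall>n. \<forall>x \<in> mspace m. f n x \<in> Prob (mspace m)) \<and>
        (\<exists>S :: nat \<Rightarrow> real. \<forall>n. \<forall>x \<in> mspace m.
           {y \<in> mspace m. f n x y \<noteq> 0} \<subseteq> mcball_of m x (S n)) \<and>
        (\<forall>R>0. uniform_limit
           {(x0, x1). x0 \<in> mspace m \<and> x1 \<in> mspace m \<and> mdist m x0 x1 \<le> R}
           (\<lambda>n (x0, x1). l1_norm (mspace m) (\<lambda>y. f n x1 y - f n x0 y))
           (\<lambda>_. 0) sequentially))"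


section \<open>Disjoint unions\<close>

definition component :: "(nat \<Rightarrow> 'a pair_pre_digraph) \<Rightarrow> nat \<Rightarrow> (nat \<times> 'a) set" where
  "component \<Gamma> i = {i} \<times> pverts (\<Gamma> i)"

definition disjoint_union :: "(nat \<Rightarrow> 'a pair_pre_digraph) \<Rightarrow> (nat \<times> 'a) set" where
  "disjoint_union \<Gamma> = (\<Union>i. component \<Gamma> i)"

end

theory Submission
  imports Defs
begin

text \<open>
  Let \<open>f\<close> witness property A, and fix \<open>n\<close> with \<open>f n\<close> varying by at most a small \<open>\<delta>\<close> along edges. For large \<open>i\<close> the functions
  \<open>f n x\<close> with \<open>x\<close> in \<open>\<Gamma> i\<close> are supported in \<open>\<Gamma> i\<close>, and by bounded valency each
  slice \<open>\<lambda>x. f n x y\<close> has support of at most half the size of \<open>\<Gamma> i\<close>. The co-area form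
  of the Cheeger inequality bounds the total variation of a slice along the edges from below by
  \<open>2 * \<epsilon>\<close> times its sum. Summing over \<open>y\<close> gives \<open>2 * \<epsilon> * |\<Gamma> i| \<le> \<delta> * k * |\<Gamma> i|\<close>.
\<close>

section \<open>Cheeger inequality for functions of small support\<close>

lemma sum_indicator:
  assumes "finite B" "A \<subseteq> B"
  shows "(\<Sum>x\<in>B. indicator A x) = real (card A)"
  using assms by (simp add: indicator_def of_bool_def sum.If_cases Int_absorb1)

text \<open>The induction subtracts from \<open>g\<close> its least positive value, on the support of \<open>g\<close>.\<close>

lemma coarea_isoperimetric:
  fixes g :: "'a \<Rightarrow> real" and c :: real and E :: "('a \<times> 'a) set"
  assumes "finite V" "finite E" "E \<subseteq> V \<times> V"
    and iso: "\<And>F. F \<subseteq> V \<Longrightarrow> F \<noteq> {} \<Longrightarrow> card F \<le> N \<Longrightarrow>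
      c * card F \<le> card {(x, y) \<in> E. (x \<in> F) \<noteq> (y \<in> F)}"
    and "\<And>x. x \<in> V \<Longrightarrow> 0 \<le> g x"
    and "card {x \<in> V. g x \<noteq> 0} \<le> N"
  shows "c * (\<Sum>x\<in>V. g x) \<le> (\<Sum>(x, y)\<in>E. \<bar>g x - g y\<bar>)"
  using assms(5,6)
proof (induction "card {x \<in> V. g x \<noteq> 0}" arbitrary: g rule: less_induct)
  case less
  define F where "F = {x \<in> V. g x \<noteq> 0}"
  have F: "F \<subseteq> V" "finite F" "card F \<le> N"
    using less.prems assms(1) by (auto simp: F_def)
  show ?case
  proof (cases "F = {}")
    case True
    then have "(\<Sum>x\<in>V. g x) = 0"
      by (auto simp: F_def intro!: sum.neutral)
    then show ?thesis by (auto intro!: sum_nonneg)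
  next
    case False
    define t where "t = Min (g ` F)"
    define g' where "g' x = (if x \<in> F then g x - t else 0)" for x
    have "t \<in> g ` F" and t_le: "\<And>x. x \<in> F \<Longrightarrow> t \<le> g x"
      using F False by (auto simp: t_def)
    then obtain z where z: "z \<in> F" "g z = t" by auto
    have "0 < t" using z less.prems(1)[of z] by (auto simp: F_def)
    \<comment> \<open>The minimum \<open>t\<close> is attained at \<open>z\<close>, so
      \<open>z\<close> leaves the support and the induction measure drops.\<close>
    have sub: "{x \<in> V. g' x \<noteq> 0} \<subset> F"
      using z F by (auto simp: g'_def)
    then have less_card: "card {x \<in> V. g' x \<noteq> 0} < card F"
      by (rule psubset_card_mono[OF F(2)])
    have IH: "c * (\<Sum>x\<in>V. g' x) \<le> (\<Sum>(x, y)\<in>E. \<bar>g' x - g' y\<bar>)"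
      using less_card F t_le by (intro less.hyps) (auto simp: F_def g'_def)
    have g: "g x = g' x + t * indicator F x" if "x \<in> V" for x
      using that by (auto simp: g'_def F_def)
    let ?B = "{(x, y) \<in> E. (x \<in> F) \<noteq> (y \<in> F)}"
    have "(\<Sum>x\<in>V. g x) = (\<Sum>x\<in>V. g' x + t * indicator F x)"
      using g by (intro sum.cong) auto
    also have "\<dots> = (\<Sum>x\<in>V. g' x) + t * card F"
      using F assms(1) by (simp add: sum.distrib sum_distrib_left[symmetric] sum_indicator)
    finally have "c * (\<Sum>x\<in>V. g x) = c * (\<Sum>x\<in>V. g' x) + t * (c * card F)"
      by (simp add: algebra_simps)
    also have "\<dots> \<le> (\<Sum>(x, y)\<in>E. \<bar>g' x - g' y\<bar>) + t * card ?B"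
      using iso[OF F(1) False F(3)] \<open>0 < t\<close> by (intro add_mono IH mult_left_mono) auto
    also have "\<dots> = (\<Sum>e\<in>E. (case e of (x, y) \<Rightarrow> \<bar>g' x - g' y\<bar>) + t * indicator ?B e)"
      using assms(2)
      by (subst sum.distrib, subst sum_distrib_left[symmetric], subst sum_indicator) auto
    \<comment> \<open>Equality holds arc by arc. With both ends in \<open>F\<close> the shift by
      \<open>t\<close> cancels; with one end in \<open>F\<close>, \<open>g'\<close> vanishes at the
      other and is non-negative at this one, since \<open>t\<close> is the minimum on
      \<open>F\<close>, so exactly \<open>t\<close> is gained.\<close>
    also have "\<dots> = (\<Sum>(x, y)\<in>E. \<bar>g x - g y\<bar>)"
    proof (intro sum.cong refl)
      fix e assume "e \<in> E"
      then obtain x y where "e = (x, y)" "x \<in> V" "y \<in> V" "(x, y) \<in> E"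
        using assms(3) by (cases e) auto
      then show "(case e of (x, y) \<Rightarrow> \<bar>g' x - g' y\<bar>) + t * indicator ?B e
          = (case e of (x, y) \<Rightarrow> \<bar>g x - g y\<bar>)"
        using t_le[of x] t_le[of y] \<open>0 < t\<close>
        by (cases "x \<in> F"; cases "y \<in> F") (auto simp: g'_def F_def)
    qed
    finally show ?thesis .
  qed
qed

text \<open>\<open>F\<close> is one competitor in the infimum. The factor 2 clears the
  \<open>1 / 2\<close> of \<open>cheeger_constant\<close>, and finiteness makes
  \<open>card F\<close> positive, so the quotient can be multiplied out.\<close>

lemma expander_edge_boundary:
  assumes "expander k \<epsilon> G" "F \<subseteq> pverts G" "F \<noteq> {}"
    and "real (card F) \<le> real (card (pverts G)) / 2" and "finite (pverts G)"
  shows "2 * \<epsilon> * card F \<le> card (edge_boundary G F)"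
proof -
  have "ereal \<epsilon> \<le> cheeger_constant G"
    using assms(1) by (simp add: expander_def)
  also have "\<dots> \<le> ereal (1 / 2) * ereal (card (edge_boundary G F) / card F)"
    unfolding cheeger_constant_def using assms(2-4)
    by (intro ereal_mult_left_mono INF_lower) auto
  finally have "\<epsilon> \<le> card (edge_boundary G F) / card F / 2" by simp
  moreover have "0 < card F"
    using assms finite_subset card_gt_0_iff by metis
  ultimately show ?thesis by (simp add: field_simps)
qed

section \<open>Counting arcs and balls in graphs of bounded valency\<close>

lemma card_parcs_le:
  assumes "finite_graph G" "\<And>v. v \<in> pverts G \<Longrightarrow> valency G v \<le> k"
  shows "card (parcs G) \<le> k * card (pverts G)"
proof -
  interpret pair_pseudo_graph G using assms(1) by (simp add: finite_graph_def)
  have "parcs G = (\<Union>v\<in>pverts G. out_arcs G v)"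
    by (auto simp: out_arcs_def dest: in_arcsD1)
  then have "card (parcs G) \<le> (\<Sum>v\<in>pverts G. card (out_arcs G v))"
    by (metis card_UN_le finite_verts)
  also have "\<dots> \<le> (\<Sum>v\<in>pverts G. k)"
    using assms(2) by (intro sum_mono) (simp add: out_degree_def)
  finally show ?thesis by (simp add: mult.commute)
qed

text \<open>Adding all out-neighbours multiplies the size of a set by at most \<open>k + 1\<close>,
  and \<open>r\<close> such rounds exhaust the ball. The bound does not depend on the size of the
  graph.\<close>

lemma card_graph_ball_le:
  assumes "finite_graph G" "\<And>v. v \<in> pverts G \<Longrightarrow> valency G v \<le> k"
    and u: "u \<in> pverts G"
  shows "card {v \<in> pverts G. graph_dist G u v \<le> ereal (real r)} \<le> Suc k ^ r"
proof -
  interpret pair_pseudo_graph G using assms(1) by (simp add: finite_graph_def)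
  \<comment> \<open>\<open>N n\<close> collects the vertices reached from \<open>u\<close> by walks
    of length at most \<open>n\<close>.\<close>
  define N where "N = rec_nat {u} (\<lambda>_ A. A \<union> (\<Union>v\<in>A. {w. (v, w) \<in> parcs G}))"
  have N: "N 0 = {u}" "\<And>n. N (Suc n) = N n \<union> (\<Union>v\<in>N n. {w. (v, w) \<in> parcs G})"
    by (simp_all add: N_def)
  have sub: "N n \<subseteq> pverts G" for n
    using u by (induction n) (auto simp: N dest: in_arcsD2)
  have fin: "finite (N n)" for n
    using sub finite_subset finite_verts by metis
  have nbr: "card {w. (v, w) \<in> parcs G} \<le> k" if "v \<in> pverts G" for v
  proof -
    have "{w. (v, w) \<in> parcs G} = snd ` out_arcs G v"
      by (force simp: out_arcs_def)
    then have "card {w. (v, w) \<in> parcs G} \<le> card (out_arcs G v)"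
      by (metis card_image_le finite_out_arcs)
    then show ?thesis using assms(2)[OF that] by (simp add: out_degree_def)
  qed
  have card: "card (N n) \<le> Suc k ^ n" for n
  proof (induction n)
    case (Suc n)
    have "card (N (Suc n)) \<le> card (N n) + card (\<Union>v\<in>N n. {w. (v, w) \<in> parcs G})"
      by (simp add: N card_Un_le)
    also have "card (\<Union>v\<in>N n. {w. (v, w) \<in> parcs G}) \<le> (\<Sum>v\<in>N n. card {w. (v, w) \<in> parcs G})"
      by (intro card_UN_le fin)
    also have "\<dots> \<le> (\<Sum>v\<in>N n. k)"
      using sub nbr by (intro sum_mono) auto
    also have "card (N n) + (\<Sum>v\<in>N n. k) = card (N n) * Suc k" by simp
    also have "\<dots> \<le> Suc k ^ n * Suc k" using Suc by (rule mult_le_mono1)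
    finally show ?case by (simp add: mult.commute)
  qed (simp add: N)
  have mono: "N n \<subseteq> N (n + d)" for n d
    by (induction d) (auto simp: N)
  \<comment> \<open>The start \<open>w\<close> and the level \<open>n\<close> are kept general
    because the induction peels off the first arc of the walk.\<close>
  have walk: "v \<in> N (n + length p)" if "awalk w p v" "w \<in> N n" for w p v n
    using that
  proof (induction p arbitrary: w n)
    case (Cons e p)
    then have e: "e \<in> parcs G" "fst e = w" "awalk (snd e) p v"
      by (auto simp: awalk_Cons_iff)
    then have "snd e \<in> N (Suc n)" using Cons.prems by (cases e) (auto simp: N)
    from Cons.IH[OF e(3) this] show ?case by simp
  qed (simp add: awalk_Nil_iff)
  have "{v \<in> pverts G. graph_dist G u v \<le> ereal (real r)} \<subseteq> N r"
  proof clarify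
    fix v assume "graph_dist G u v \<le> ereal (real r)"
    \<comment> \<open>A strict bound is needed to extract a walk from the infimum; as lengths are
      integers, less than \<open>r + 1\<close> gives at most \<open>r\<close>.\<close>
    then have "\<mu> (\<lambda>_. 1) u v < ereal (real r + 1)"
      unfolding graph_dist_def by (rule le_less_trans) simp
    then obtain p where p: "awalk u p v" "awalk_cost (\<lambda>_. 1) p < real r + 1"
      unfolding \<mu>_def by (auto simp: INF_less_iff)
    have "length p \<le> r" using p(2) by (simp add: awalk_cost_def sum_list_triv)
    then show "v \<in> N r"
      using walk[OF p(1), of 0] mono[of "length p" "r - length p"] by (auto simp: N)
  qed
  then show ?thesis using card[of r] card_mono[OF fin] le_trans by blast
qed

text \<open>The arc itself is a walk of cost 1. Equality fails for loops, whose ends have distance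
  0.\<close>

lemma graph_dist_arc_le:
  assumes "finite_graph G" "(u, v) \<in> parcs G"
  shows "graph_dist G u v \<le> 1"
proof -
  interpret pair_pseudo_graph G using assms(1) by (simp add: finite_graph_def)
  have "awalk u [(u, v)] v"
    using assms(2) in_arcsD1 in_arcsD2 by (auto simp: awalk_simps)
  then show ?thesis
    unfolding graph_dist_def using min_cost_le_walk_cost[of u "[(u, v)]" v "\<lambda>_. 1"]
    by (simp add: awalk_cost_def one_ereal_def)
qed

section \<open>Property A contradicts expansion\<close>

theorem corollary4p2:
  fixes \<Gamma> :: "nat \<Rightarrow> 'a pair_pre_digraph"
    and m :: "(nat \<times> 'a) metric"
  assumes "expander_sequence \<Gamma>"
    and "mspace m = disjoint_union \<Gamma>"
    and "proper_metric m"
    and "\<And>i x y. x \<in> pverts (\<Gamma> i) \<Longrightarrow> y \<in> pverts (\<Gamma> i) \<Longrightarrow>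
           ereal (mdist m (i, x) (i, y)) = graph_dist (\<Gamma> i) x y"
    and "filterlim
           (\<lambda>i. set_dist m (component \<Gamma> i) (disjoint_union \<Gamma> - component \<Gamma> i))
           at_top sequentially"
  shows "\<not> property_A m"
proof
  assume "property_A m"
  then obtain f :: "nat \<Rightarrow> nat \<times> 'a \<Rightarrow> nat \<times> 'a \<Rightarrow> real" and S :: "nat \<Rightarrow> real"
    where prob: "\<And>n x. x \<in> mspace m \<Longrightarrow> f n x \<in> Prob (mspace m)"
      and supp_mcball: "\<And>n x. x \<in> mspace m \<Longrightarrow>
        {y \<in> mspace m. f n x y \<noteq> 0} \<subseteq> mcball_of m x (S n)"
      and lim: "\<And>R. R > 0 \<Longrightarrow> uniform_limit
         {(x0, x1). x0 \<in> mspace m \<and> x1 \<in> mspace m \<and> mdist m x0 x1 \<le> R}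
         (\<lambda>n (x0, x1). l1_norm (mspace m) (\<lambda>y. f n x1 y - f n x0 y))
         (\<lambda>_. 0) sequentially"
    unfolding property_A_def by blast
  have supp: "mdist m x y \<le> S n"
    if "x \<in> mspace m" "y \<in> mspace m" "f n x y \<noteq> 0" for n x y
    using supp_mcball[OF that(1), of n] that
    by (auto simp: mcball_of_def Metric_space.in_mcball[OF Metric_space_mspace_mdist])
  from assms(1) obtain k \<epsilon> where graph: "\<And>i. finite_graph (\<Gamma> i)"
    and big: "filterlim (\<lambda>i. card (pverts (\<Gamma> i))) at_top sequentially"
    and "\<epsilon> > 0" and exp: "\<And>i. expander k \<epsilon> (\<Gamma> i)"
    unfolding expander_sequence_def by blast
  \<comment> \<open>Chosen so that \<open>k * \<delta> < 2 * \<epsilon>\<close>; the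
    \<open>+ 1\<close> covers \<open>k = 0\<close>.\<close>
  define \<delta> where "\<delta> = \<epsilon> / (k + 1)"
  have "\<delta> > 0" using \<open>\<epsilon> > 0\<close> by (simp add: \<delta>_def)
  \<comment> \<open>Radius \<open>R = 1\<close> suffices, as only pairs joined by an arc are
    compared. Fixing \<open>n\<close> here fixes the support radius \<open>S n\<close> before
    \<open>i\<close> is chosen.\<close>
  obtain n where n: "\<And>x0 x1. x0 \<in> mspace m \<Longrightarrow> x1 \<in> mspace m \<Longrightarrow> mdist m x0 x1 \<le> 1 \<Longrightarrow>
      \<bar>l1_norm (mspace m) (\<lambda>y. f n x1 y - f n x0 y)\<bar> < \<delta>"
    using eventually_happens[OF uniform_limitD[OF lim[of 1] \<open>\<delta> > 0\<close>]] by fastforce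
  define r where "r = nat \<lceil>S n\<rceil>"
  have r: "S n \<le> real r" unfolding r_def by linarith
  \<comment> \<open>The first condition confines supports to one component; the second makes a ball
    of radius \<open>r\<close> fill at most half of it.\<close>
  have "eventually (\<lambda>i. S n < set_dist m (component \<Gamma> i) (disjoint_union \<Gamma> - component \<Gamma> i)
      \<and> 2 * Suc k ^ r \<le> card (pverts (\<Gamma> i))) sequentially"
    using assms(5) big by (intro eventually_conj) (auto simp: filterlim_at_top_dense filterlim_at_top)
  then obtain i where far: "S n < set_dist m (component \<Gamma> i) (disjoint_union \<Gamma> - component \<Gamma> i)"
    and large: "2 * Suc k ^ r \<le> card (pverts (\<Gamma> i))"
    using eventually_happens by force

  define V where "V = pverts (\<Gamma> i)"
  define E where "E = parcs (\<Gamma> i)"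
  define g where "g x y = f n (i, x) (i, y)" for x y
  interpret pair_pseudo_graph "\<Gamma> i" using graph[of i] by (simp add: finite_graph_def)
  have "finite V" "finite E" "V \<noteq> {}"
    using graph[of i] finite_verts finite_arcs by (auto simp: V_def E_def finite_graph_def)
  have E_V: "E \<subseteq> V \<times> V" using in_arcsD1 in_arcsD2 by (auto simp: E_def V_def)
  have val: "valency (\<Gamma> i) v \<le> k" if "v \<in> pverts (\<Gamma> i)" for v
    using exp[of i] that by (simp add: expander_def)
  have comp: "component \<Gamma> i = Pair i ` V" by (auto simp: component_def V_def)
  have in_space: "(i, x) \<in> mspace m" if "x \<in> V" for x
    using that by (auto simp: assms(2) disjoint_union_def component_def V_def)

  have outside: "f n (i, x) z = 0" if "x \<in> V" "z \<in> mspace m - Pair i ` V" for x z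
  proof (rule ccontr)
    assume "f n (i, x) z \<noteq> 0"
    then have "mdist m (i, x) z \<le> S n"
      using supp in_space that by blast
    moreover have "set_dist m (component \<Gamma> i) (disjoint_union \<Gamma> - component \<Gamma> i) \<le> mdist m (i, x) z"
      \<comment> \<open>The infimum is taken in the reals, so the lower bound 0 has to be
        supplied.\<close>
      unfolding set_dist_def comp using that assms(2)
      by (intro cINF_lower2[where x = "((i, x), z)"] bdd_belowI[where m = 0]) auto
    ultimately show False using far by simp
  qed
  \<comment> \<open>Turns the sums over the infinite space in \<open>Prob\<close> and
    \<open>l1_norm\<close> into finite sums over \<open>V\<close>.\<close>
  have infsum_V: "(\<Sum>\<^sub>\<infinity>z\<in>mspace m. h z) = (\<Sum>y\<in>V. h (i, y))"
    if "\<And>z. z \<in> mspace m - Pair i ` V \<Longrightarrow> h z = 0" for h :: "nat \<times> 'a \<Rightarrow> real"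
  proof -
    have "(\<Sum>\<^sub>\<infinity>z\<in>mspace m. h z) = (\<Sum>\<^sub>\<infinity>z\<in>Pair i ` V. h z)"
      using that in_space by (intro infsum_cong_neutral) auto
    also have "\<dots> = (\<Sum>y\<in>V. h (i, y))"
      using \<open>finite V\<close> by (simp add: sum.reindex inj_on_def)
    finally show ?thesis .
  qed
  have g_nonneg: "0 \<le> g x y" if "x \<in> V" "y \<in> V" for x y
    using prob[OF in_space[OF that(1)], of n] in_space[OF that(2)] by (simp add: Prob_def g_def)
  have g_sum: "(\<Sum>y\<in>V. g x y) = 1" if "x \<in> V" for x
    using prob[OF in_space[OF that], of n] infsum_V[OF outside[OF that]]
    by (simp add: Prob_def g_def)
  have g_edge: "(\<Sum>y\<in>V. \<bar>g a y - g b y\<bar>) \<le> \<delta>" if "(a, b) \<in> E" for a b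
  proof -
    have ab: "a \<in> V" "b \<in> V" using that E_V by auto
    have "ereal (mdist m (i, a) (i, b)) \<le> 1"
      using graph_dist_arc_le[OF graph[of i]] that ab assms(4) by (simp add: V_def E_def)
    then have "mdist m (i, b) (i, a) \<le> 1"
      by (simp add: one_ereal_def mdist_commute)
    from n[OF in_space[OF ab(2)] in_space[OF ab(1)] this]
    have "l1_norm (mspace m) (\<lambda>y. f n (i, a) y - f n (i, b) y) \<le> \<delta>" by simp
    then show ?thesis
      unfolding l1_norm_def g_def using outside ab by (subst (asm) infsum_V) auto
  qed
  \<comment> \<open>Here \<open>y\<close> is fixed and \<open>x\<close> varies: by symmetry of the
    metric, \<open>y\<close> lies in the ball about \<open>x\<close> only if \<open>x\<close> lies
    in the ball about \<open>y\<close>.\<close>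
  have g_supp: "card {x \<in> V. g x y \<noteq> 0} \<le> Suc k ^ r" if "y \<in> V" for y
  proof -
    have "{x \<in> V. g x y \<noteq> 0} \<subseteq> {x \<in> pverts (\<Gamma> i). graph_dist (\<Gamma> i) y x \<le> ereal (real r)}"
    proof clarify
      fix x assume x: "x \<in> V" "g x y \<noteq> 0"
      then have "mdist m (i, x) (i, y) \<le> S n"
        using supp in_space that unfolding g_def by blast
      then have "ereal (mdist m (i, y) (i, x)) \<le> ereal (real r)"
        using r by (simp add: mdist_commute)
      then show "x \<in> pverts (\<Gamma> i) \<and> graph_dist (\<Gamma> i) y x \<le> ereal (real r)"
        using x that by (simp add: V_def flip: assms(4))
    qed
    then have "card {x \<in> V. g x y \<noteq> 0}
        \<le> card {x \<in> pverts (\<Gamma> i). graph_dist (\<Gamma> i) y x \<le> ereal (real r)}"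
      using \<open>finite V\<close> by (intro card_mono) (auto simp: V_def)
    also have "\<dots> \<le> Suc k ^ r"
      using that by (intro card_graph_ball_le graph val) (auto simp: V_def)
    finally show ?thesis .
  qed
  have iso: "2 * \<epsilon> * card F \<le> card {(x, y) \<in> E. (x \<in> F) \<noteq> (y \<in> F)}"
    if "F \<subseteq> V" "F \<noteq> {}" "card F \<le> Suc k ^ r" for F
  proof -
    have "2 * card F \<le> card (pverts (\<Gamma> i))" using that(3) large by linarith
    then have "real (card F) \<le> real (card (pverts (\<Gamma> i))) / 2" by linarith
    then show ?thesis
      using expander_edge_boundary[OF exp[of i], of F] that \<open>finite V\<close>
      by (simp add: V_def E_def edge_boundary_def)
  qed
  \<comment> \<open>Double counting: every \<open>g x\<close> has mass 1, so the slices together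
    have mass \<open>card V\<close>.\<close>
  have "2 * \<epsilon> * card V = (\<Sum>y\<in>V. 2 * \<epsilon> * (\<Sum>x\<in>V. g x y))"
    unfolding sum_distrib_left[symmetric] using g_sum by (subst sum.swap) simp
  \<comment> \<open>The co-area bound is applied to each slice, with \<open>N = Suc k ^ r\<close>
    and \<open>c = 2 * \<epsilon>\<close>.\<close>
  also have "\<dots> \<le> (\<Sum>y\<in>V. \<Sum>(a, b)\<in>E. \<bar>g a y - g b y\<bar>)"
    using \<open>finite V\<close> \<open>finite E\<close> E_V iso g_nonneg g_supp
    by (intro sum_mono coarea_isoperimetric) auto
  also have "\<dots> = (\<Sum>(a, b)\<in>E. \<Sum>y\<in>V. \<bar>g a y - g b y\<bar>)"
    by (subst sum.swap) (simp add: case_prod_unfold)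
  also have "\<dots> \<le> (\<Sum>e\<in>E. \<delta>)"
    using g_edge by (intro sum_mono) auto
  also have "\<dots> \<le> real (k * card V) * \<delta>"
    using card_parcs_le[OF graph[of i] val] \<open>\<delta> > 0\<close> unfolding E_def V_def
    by (simp only: sum_constant of_nat_le_iff mult_right_mono less_imp_le)
  also have "\<dots> = (k * \<delta>) * card V" by simp
  also have "\<dots> < 2 * \<epsilon> * card V"
  proof (rule mult_strict_right_mono)
    have "k * \<epsilon> < 2 * \<epsilon> * (k + 1)"
      using \<open>\<epsilon> > 0\<close> by (simp add: algebra_simps add_nonneg_pos)
    then show "k * \<delta> < 2 * \<epsilon>" by (simp add: \<delta>_def field_simps)
    show "0 < real (card V)" using \<open>finite V\<close> \<open>V \<noteq> {}\<close> by (simp add: card_gt_0_iff)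
  qed
  finally show False by simp
qed

end
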